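(* Let $x_1,\dots,x_n\in\mathbb{R}^d$ ($d\ge 1$) be a data set. Consider the following algorithm (ABCDepth, Algorithm 1, for an approximate Tukey median): (Phase 1) for every $i=2,\dots,n$ and $j=1,\dots,i-1$ compute the Euclidean distance $\|x_i-x_j\|$ and store it in a triangular list-of-lists structure; (Phase 2) for every $i=1,\dots,n$, sort (by quicksort) the distances from $x_i$ to the sample points and store, in a hash map keyed by the center $x_i$, the list of sample points ordered by distance from $x_i$, so that for any $m$ the set $B_i^{(m)}$ of the $m$ sample points nearest to $x_i$ (i.e. the sample points in the closed ball centered at $x_i$ whose radius is the $m$-th smallest distance from $x_i$ to the sample points) is available; (Phase 3, iteration) set $\alpha_1=\frac{1}{d+1}$, $\mathrm{size}=n$, $k=1$; while $\mathrm{size}>1$: compute $S_{\alpha_k}=\bigcap_{j=1}^n B_j^{(m_k)}$ with $m_k=\lfloor n(1-\alpha_k)+1\rfloor$ (intersections of hash-based sets), set $\mathrm{size}=|S_{\alpha_k}|$, $\alpha_{k+1}=\alpha_k+\frac1n$, record $S_{\alpha_k}$, and increase $k$ by $1$. Then this algorithm runs in time $O\big((d+k)n^2+n^2\log n\big)$, where $k$ is the number of iterations performed in the iteration phase.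
   Context: Time is measured counting arithmetic operations on real numbers as unit cost; sorting $n$ numbers by quicksort takes $O(n\log n)$ comparisons, and operations on the hash-based set/map structures (insertion, lookup, membership) take constant time, so that intersecting two such sets of size at most $n$ takes $O(n)$ time. The output sets $S_{\alpha}$ serve as approximations of the Tukey (halfspace) depth level sets $\{x: D(x)\ge n-\lceil n\alpha\rceil+1\}$, where $D(x)=\min_{\|u\|=1}\#\{i: \langle u,x_i\rangle\le\langle u,x\rangle\}$, and the last nonempty one as an approximate Tukey median. *)

theory Defs
  imports
    "HOL-Analysis.Analysis"
    "HOL-Library.Monad_Syntax"
    "HOL-Library.While_Combinator"
    "HOL-Library.Landau_Symbols"
    "HOL-Library.Multiset"
begin

text \<open>
  Points are coordinate lists, because the constant hidden in the O-bound must not depend on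
  the dimension \<open>d\<close> (so \<open>d\<close> has to be quantified inside the statement).
\<close>

type_synonym point = "real list"

subsection \<open>Computations that count their elementary operations\<close>

datatype 'a tm = TM (val: 'a) (time: nat)

definition return_tm :: "'a \<Rightarrow> 'a tm" where
  "return_tm v = TM v 0"

definition bind_tm :: "'a tm \<Rightarrow> ('a \<Rightarrow> 'b tm) \<Rightarrow> 'b tm" where
  "bind_tm m f = TM (val (f (val m))) (time m + time (f (val m)))"

adhoc_overloading Monad_Syntax.bind \<rightleftharpoons> bind_tm

lemma bind_tm_cong [fundef_cong]:
  "m = m' \<Longrightarrow> (\<And>v. v = val m' \<Longrightarrow> f v = f' v) \<Longrightarrow> bind_tm m f = bind_tm m' f'"
  by (simp add: bind_tm_def)

text \<open>
  \<open>op v\<close> performs a single unit-cost operation with result \<open>v\<close>: one arithmetic operation or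
  comparison of real (or integer) numbers, or one read of an indexed sequence.
\<close>

definition op :: "'a \<Rightarrow> 'a tm" where
  "op v = TM v 1"

text \<open>Every pass of the loops below is charged one unit in addition to the cost of its body.\<close>

primrec map_tm :: "('a \<Rightarrow> 'b tm) \<Rightarrow> 'a list \<Rightarrow> 'b list tm" where
  "map_tm f [] = return_tm []"
| "map_tm f (x # xs) = do { y \<leftarrow> f x; ys \<leftarrow> map_tm f xs; op (y # ys) }"

primrec fold_tm :: "('a \<Rightarrow> 's \<Rightarrow> 's tm) \<Rightarrow> 'a list \<Rightarrow> 's \<Rightarrow> 's tm" where
  "fold_tm f [] s = return_tm s"
| "fold_tm f (x # xs) s = do { s' \<leftarrow> f x s; s'' \<leftarrow> op s'; fold_tm f xs s'' }"

text \<open>The result is \<open>None\<close> iff the loop does not terminate; each test of the guard costs one unit.\<close>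

definition while_tm :: "('s \<Rightarrow> bool) \<Rightarrow> ('s \<Rightarrow> 's tm) \<Rightarrow> 's \<Rightarrow> 's tm option" where
  "while_tm b c s =
     while_option (\<lambda>m. b (val m)) (\<lambda>m. do { s' \<leftarrow> m; s'' \<leftarrow> c s'; op s'' }) (op s)"

subsection \<open>Quicksort\<close>

text \<open>
  Quicksort on records with a numeric key (first component), with a partition into smaller, equal
  and larger keys; \<open>pivot\<close> is the rule that selects the pivot position from the list of keys.
  (Without a separate part for equal keys, ties would force quadratic time for every pivot rule.)
  The time is the number of comparisons of keys.
\<close>

fun split3_tm :: "real \<Rightarrow> (real \<times> 'a) list \<Rightarrow>
    ((real \<times> 'a) list \<times> (real \<times> 'a) list \<times> (real \<times> 'a) list) tm" where
  "split3_tm p [] = return_tm ([], [], [])"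
| "split3_tm p (z # zs) = do {
     (l, e, g) \<leftarrow> split3_tm p zs;
     lt \<leftarrow> op (fst z < p);
     if lt then return_tm (z # l, e, g)
     else do {
       gt \<leftarrow> op (p < fst z);
       return_tm (if gt then (l, e, z # g) else (l, z # e, g))
     }
   }"

lemma val_split3_tm:
  "val (split3_tm p zs) =
     (filter (\<lambda>z. fst z < p) zs, filter (\<lambda>z. fst z = p) zs, filter (\<lambda>z. p < fst z) zs)"
  by (induction zs) (auto simp: bind_tm_def return_tm_def op_def)

definition pivot_key :: "(real list \<Rightarrow> nat) \<Rightarrow> (real \<times> 'a) list \<Rightarrow> real" where
  "pivot_key pivot zs = map fst zs ! (pivot (map fst zs) mod length zs)"

lemma pivot_key_in: "zs \<noteq> [] \<Longrightarrow> pivot_key pivot zs \<in> fst ` set zs"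
  unfolding pivot_key_def by (metis length_map length_greater_0_conv list.set_map
    mod_less_divisor nth_mem)

function quicksort_tm :: "(real list \<Rightarrow> nat) \<Rightarrow> (real \<times> 'a) list \<Rightarrow> (real \<times> 'a) list tm" where
  "quicksort_tm pivot zs =
     (if length zs \<le> 1 then return_tm zs
      else do {
        (l, e, g) \<leftarrow> split3_tm (pivot_key pivot zs) zs;
        l' \<leftarrow> quicksort_tm pivot l;
        g' \<leftarrow> quicksort_tm pivot g;
        return_tm (l' @ e @ g')
      })"
  by auto
termination
proof (relation "Wellfounded.measure (\<lambda>(pivot, zs). length zs)", goal_cases)
  case 1
  show ?case by simp
next
  case (2 pivot zs x l y e g)
  then have "pivot_key pivot zs \<in> fst ` set zs"
    by (intro pivot_key_in) auto
  with 2 show ?case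
    by (auto simp: val_split3_tm intro!: length_filter_less)
next
  case (3 pivot zs x l y e g)
  then have "pivot_key pivot zs \<in> fst ` set zs"
    by (intro pivot_key_in) auto
  with 3 show ?case
    by (auto simp: val_split3_tm intro!: length_filter_less)
qed

declare quicksort_tm.simps [simp del]

subsection \<open>Hash-based sets and maps\<close>

text \<open>
  A hash set is represented by the duplicate-free list of its elements in iteration order, a hash
  map by the function it denotes. The parameter \<open>h\<close> is the constant cost of one operation
  (insertion, lookup, membership), whatever the size of the structure.
\<close>

definition set_insert_tm :: "nat \<Rightarrow> 'a \<Rightarrow> 'a list \<Rightarrow> 'a list tm" where
  "set_insert_tm h x s = TM (List.insert x s) h"

definition set_member_tm :: "nat \<Rightarrow> 'a \<Rightarrow> 'a list \<Rightarrow> bool tm" where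
  "set_member_tm h x s = TM (x \<in> set s) h"

definition map_put_tm :: "nat \<Rightarrow> 'k \<Rightarrow> 'v \<Rightarrow> ('k \<rightharpoonup> 'v) \<Rightarrow> ('k \<rightharpoonup> 'v) tm" where
  "map_put_tm h x v M = TM (M(x \<mapsto> v)) h"

definition map_get_tm :: "nat \<Rightarrow> 'k \<Rightarrow> ('k \<rightharpoonup> 'v) \<Rightarrow> 'v tm" where
  "map_get_tm h x M = TM (the (M x)) h"

definition set_inter_tm :: "nat \<Rightarrow> 'a list \<Rightarrow> 'a list \<Rightarrow> 'a list tm" where
  "set_inter_tm h s t = fold_tm (\<lambda>y r. do {
     b \<leftarrow> set_member_tm h y t;
     if b then set_insert_tm h y r else return_tm r
   }) s []"

subsection \<open>The algorithm\<close>

fun sq_dist_tm :: "point \<Rightarrow> point \<Rightarrow> real tm" where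
  "sq_dist_tm (a # x) (b # y) = do {
     s \<leftarrow> sq_dist_tm x y;
     u \<leftarrow> op (a - b);
     v \<leftarrow> op (u * u);
     op (v + s)
   }"
| "sq_dist_tm _ _ = return_tm 0"

definition euclid_dist_tm :: "point \<Rightarrow> point \<Rightarrow> real tm" where
  "euclid_dist_tm x y = do { s \<leftarrow> sq_dist_tm x y; op (sqrt s) }"

text \<open>
  Sample points are indexed from \<open>0\<close>. The triangular structure has the rows \<open>1, \<dots>, n - 1\<close>
  (stored at positions \<open>0, \<dots>, n - 2\<close>); row \<open>i\<close> holds the distances of point \<open>i\<close> to the
  points \<open>0, \<dots>, i - 1\<close>.
\<close>

definition phase1_tm :: "point list \<Rightarrow> real list list tm" where
  "phase1_tm xs = map_tm (\<lambda>i. map_tm (\<lambda>j. do {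
     x \<leftarrow> op (xs ! i);
     y \<leftarrow> op (xs ! j);
     euclid_dist_tm x y
   }) [0..<i]) [1..<length xs]"

definition stored_dist_tm :: "real list list \<Rightarrow> nat \<Rightarrow> nat \<Rightarrow> real tm" where
  "stored_dist_tm tri i j =
     (if j < i then op (tri ! (i - 1) ! j)
      else if i < j then op (tri ! (j - 1) ! i)
      else op 0)"

text \<open>
  The stored ordered list keeps each sample point together with its distance from the center,
  so that the radius of a ball can be read off.
\<close>

definition phase2_tm :: "(real list \<Rightarrow> nat) \<Rightarrow> nat \<Rightarrow> point list \<Rightarrow> real list list \<Rightarrow>
    (point \<rightharpoonup> (real \<times> point) list) tm" where
  "phase2_tm pivot h xs tri = fold_tm (\<lambda>i M. do {
     x \<leftarrow> op (xs ! i);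
     ds \<leftarrow> map_tm (\<lambda>j. do {
       r \<leftarrow> stored_dist_tm tri i j;
       y \<leftarrow> op (xs ! j);
       return_tm (r, y)
     }) [0..<length xs];
     zs \<leftarrow> quicksort_tm pivot ds;
     map_put_tm h x zs M
   }) [0..<length xs] Map.empty"

fun collect_tm :: "nat \<Rightarrow> real \<Rightarrow> (real \<times> point) list \<Rightarrow> point list \<Rightarrow> point list tm" where
  "collect_tm h r [] s = return_tm s"
| "collect_tm h r ((e, y) # zs) s = do {
     b \<leftarrow> op (e \<le> r);
     if b then do { s' \<leftarrow> set_insert_tm h y s; collect_tm h r zs s' }
     else return_tm s
   }"

text \<open>
  The ball around \<open>x\<close> whose radius is the \<open>m\<close>-th smallest distance; points at the same distance
  as the \<open>m\<close>-th nearest one belong to it.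
\<close>

definition ball_tm :: "nat \<Rightarrow> (point \<rightharpoonup> (real \<times> point) list) \<Rightarrow> nat \<Rightarrow> point \<Rightarrow> point list tm" where
  "ball_tm h M m x = do {
     zs \<leftarrow> map_get_tm h x M;
     z \<leftarrow> op (zs ! (m - 1));
     collect_tm h (fst z) zs []
   }"

definition level_set_tm :: "nat \<Rightarrow> point list \<Rightarrow> (point \<rightharpoonup> (real \<times> point) list) \<Rightarrow> nat \<Rightarrow>
    point list tm" where
  "level_set_tm h xs M m = do {
     x \<leftarrow> op (xs ! 0);
     B \<leftarrow> ball_tm h M m x;
     fold_tm (\<lambda>j S. do {
       y \<leftarrow> op (xs ! j);
       B' \<leftarrow> ball_tm h M m y;
       set_inter_tm h S B'
     }) [1..<length xs] B
   }"

text \<open>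
  State of the iteration: current \<open>\<alpha>\<close>, size of the last level set, counter, and the recorded
  level sets (most recent first), each with its \<open>\<alpha>\<close>; one level set is recorded per iteration.
\<close>

type_synonym abc_state = "real \<times> nat \<times> nat \<times> (real \<times> point list) list"

definition iteration_tm :: "nat \<Rightarrow> point list \<Rightarrow> (point \<rightharpoonup> (real \<times> point) list) \<Rightarrow>
    abc_state \<Rightarrow> abc_state tm" where
  "iteration_tm h xs M = (\<lambda>(\<alpha>, sz, k, Ss). do {
     a \<leftarrow> op (1 - \<alpha>);
     b \<leftarrow> op (real (length xs) * a);
     c \<leftarrow> op (b + 1);
     m \<leftarrow> op (nat \<lfloor>c\<rfloor>);
     S \<leftarrow> level_set_tm h xs M m;
     sz' \<leftarrow> op (length S);
     \<delta> \<leftarrow> op (1 / real (length xs));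
     \<alpha>' \<leftarrow> op (\<alpha> + \<delta>);
     Ss' \<leftarrow> op ((\<alpha>, S) # Ss);
     k' \<leftarrow> op (k + 1);
     return_tm (\<alpha>', sz', k', Ss')
   })"

definition phase3_tm :: "nat \<Rightarrow> point list \<Rightarrow> (point \<rightharpoonup> (real \<times> point) list) \<Rightarrow> real \<Rightarrow>
    abc_state tm option" where
  "phase3_tm h xs M \<alpha>\<^sub>1 =
     while_tm (\<lambda>(\<alpha>, sz, k, Ss). sz > 1) (iteration_tm h xs M) (\<alpha>\<^sub>1, length xs, 1, [])"

text \<open>
  The result lists the recorded pairs of \<open>\<alpha>\<close> and level set in order of computation, so its length
  is the number of iterations performed.
\<close>

definition abc_depth :: "(real list \<Rightarrow> nat) \<Rightarrow> nat \<Rightarrow> nat \<Rightarrow> point list \<Rightarrow>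
    (real \<times> point list) list tm option" where
  "abc_depth pivot h d xs =
     (let pre = do {
            tri \<leftarrow> phase1_tm xs;
            M \<leftarrow> phase2_tm pivot h xs tri;
            c \<leftarrow> op (real d + 1);
            \<alpha>\<^sub>1 \<leftarrow> op (1 / c);
            return_tm (M, \<alpha>\<^sub>1)
          }
      in case val pre of (M, \<alpha>\<^sub>1) \<Rightarrow>
           map_option
             (\<lambda>loop. case val loop of (\<alpha>, sz, k, Ss) \<Rightarrow> TM (rev Ss) (time pre + time loop))
             (phase3_tm h xs M \<alpha>\<^sub>1))"

subsection \<open>The program computes the intended objects\<close>

lemmas tm_simps = bind_tm_def return_tm_def op_def

lemma val_sq_dist: "length x = length y \<Longrightarrow> val (sq_dist_tm x y) = (\<Sum>i<length x. (x ! i - y ! i)\<^sup>2)"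
  by (induction x y rule: list_induct2)
     (simp_all add: tm_simps sum.lessThan_Suc_shift power2_eq_square del: sum.lessThan_Suc)

lemma val_euclid_dist:
  "length x = length y \<Longrightarrow> val (euclid_dist_tm x y) = L2_set (\<lambda>i. x ! i - y ! i) {..<length x}"
  by (simp add: euclid_dist_tm_def L2_set_def val_sq_dist bind_tm_def op_def)

lemma val_sq_dist_commute: "val (sq_dist_tm x y) = val (sq_dist_tm y x)"
  by (induction x y rule: sq_dist_tm.induct) (auto simp: tm_simps algebra_simps)

lemma val_sq_dist_self: "val (sq_dist_tm x x) = 0"
  by (induction x) (auto simp: tm_simps)

lemma val_map_tm: "val (map_tm f xs) = map (\<lambda>x. val (f x)) xs"
  by (induction xs) (auto simp: tm_simps)

lemma val_fold_tm: "val (fold_tm f xs s) = fold (\<lambda>x s. val (f x s)) xs s"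
  by (induction xs arbitrary: s) (auto simp: tm_simps)

lemma quicksort_tm_correct: "mset (val (quicksort_tm pivot zs)) = mset zs \<and> sorted (map fst (val (quicksort_tm pivot zs)))"
proof (induction "length zs" arbitrary: zs rule: less_induct)
  case less
  show ?case
  proof (cases "length zs \<le> 1")
    case True
    then have "val (quicksort_tm pivot zs) = zs" by (subst quicksort_tm.simps) (simp add: return_tm_def)
    then show ?thesis using True by (cases zs) auto
  next
    case False
    define p where "p = pivot_key pivot zs"
    have p: "p \<in> fst ` set zs" unfolding p_def by (rule pivot_key_in) (use False in auto)
    let ?l = "filter (\<lambda>z. fst z < p) zs" and ?e = "filter (\<lambda>z. fst z = p) zs" and ?g = "filter (\<lambda>z. p < fst z) zs"
    have l: "length ?l < length zs" "length ?g < length zs"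
      using p by (auto intro!: length_filter_less)
    note L = less[OF l(1)] and G = less[OF l(2)]
    have setL: "set (val (quicksort_tm pivot ?l)) = set ?l" using L by (metis set_mset_mset)
    have setG: "set (val (quicksort_tm pivot ?g)) = set ?g" using G by (metis set_mset_mset)
    have v: "val (quicksort_tm pivot zs) = val (quicksort_tm pivot ?l) @ ?e @ val (quicksort_tm pivot ?g)"
      using False by (subst quicksort_tm.simps) (simp add: val_split3_tm tm_simps p_def)
    have m: "mset ?l + mset ?e + mset ?g = mset zs"
      by (induction zs) auto
    have se: "sorted (map fst ?e)"
      by (induction zs) auto
    have "mset (val (quicksort_tm pivot zs)) = mset ?l + mset ?e + mset ?g"
      unfolding v using L G by simp
    moreover have "sorted (map fst (val (quicksort_tm pivot zs)))"
      unfolding v using L G se by (auto simp: sorted_append setL setG)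
    ultimately show ?thesis using m by simp
  qed
qed

lemma collect_tm_correct:
  "sorted (map fst zs) \<Longrightarrow> distinct s \<Longrightarrow>
     distinct (val (collect_tm h r zs s)) \<and>
     set (val (collect_tm h r zs s)) = set s \<union> snd ` {z \<in> set zs. fst z \<le> r}"
proof (induction zs arbitrary: s)
  case Nil
  then show ?case by (simp add: return_tm_def)
next
  case (Cons z zs)
  obtain e y where z: "z = (e, y)" by (cases z)
  show ?case
  proof (cases "e \<le> r")
    case True
    then have "{u \<in> set (z # zs). fst u \<le> r} = insert z {u \<in> set zs. fst u \<le> r}"
      by (auto simp: z)
    moreover have "val (collect_tm h r (z # zs) s) = val (collect_tm h r zs (List.insert y s))"
      using True by (simp add: z tm_simps set_insert_tm_def)
    ultimately show ?thesis
      using Cons.IH[of "List.insert y s"] Cons.prems by (simp add: z)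
  next
    case False
    then have "{u \<in> set (z # zs). fst u \<le> r} = {}"
      using Cons.prems(1) by (force simp: z)
    moreover have "val (collect_tm h r (z # zs) s) = s"
      using False by (simp add: z tm_simps)
    ultimately show ?thesis using Cons.prems by (simp only: image_empty Un_empty_right simp_thms)
  qed
qed

lemma set_inter_tm_correct: "distinct (val (set_inter_tm h s t)) \<and> set (val (set_inter_tm h s t)) = set s \<inter> set t"
proof -
  have "distinct r \<Longrightarrow> distinct (fold (\<lambda>y r. if y \<in> set t then List.insert y r else r) s r) \<and>
    set (fold (\<lambda>y r. if y \<in> set t then List.insert y r else r) s r) = set r \<union> (set s \<inter> set t)" for r
    by (induction s arbitrary: r) auto
  note this[of "[]"]
  moreover have "(\<lambda>y r. val (set_member_tm h y t \<bind> (\<lambda>b. if b then set_insert_tm h y r else return_tm r)))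
     = (\<lambda>y r. if y \<in> set t then List.insert y r else r)"
    by (auto simp: fun_eq_iff tm_simps set_member_tm_def set_insert_tm_def)
  ultimately show ?thesis unfolding set_inter_tm_def val_fold_tm by simp
qed

definition edist :: "point \<Rightarrow> point \<Rightarrow> real" where "edist x y = val (euclid_dist_tm x y)"

lemma edist_commute: "edist x y = edist y x" and edist_self: "edist x x = 0"
  by (simp_all add: edist_def euclid_dist_tm_def tm_simps val_sq_dist_self val_sq_dist_commute[of x y])

lemma val_stored_dist: "i < length xs \<Longrightarrow> j < length xs \<Longrightarrow> val (stored_dist_tm (val (phase1_tm xs)) i j) = edist (xs!i) (xs!j)"
  unfolding stored_dist_tm_def phase1_tm_def val_map_tm
  by (cases i j rule: linorder_cases) (auto simp: tm_simps edist_commute[of "xs!j" "xs!i"] edist_self simp flip: edist_def)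

lemma phase2_tm_correct:
  fixes xs h pivot
  defines "M \<equiv> val (phase2_tm pivot h xs (val (phase1_tm xs)))"
  assumes "x \<in> set xs"
  shows "M x = Some (val (quicksort_tm pivot (map (\<lambda>y. (edist x y, y)) xs)))"
proof -
  let ?q = "\<lambda>x. val (quicksort_tm pivot (map (\<lambda>y. (edist x y, y)) xs))"
  have *: "fold (\<lambda>i M. M(xs!i \<mapsto> ?q (xs!i))) is M0 x = (if x \<in> (!) xs ` set is then Some (?q x) else M0 x)" for "is" M0
    by (induction "is" arbitrary: M0) auto
  have m: "map (\<lambda>j. (val (stored_dist_tm (val (phase1_tm xs)) i j), xs ! j)) [0..<length xs] = map (\<lambda>y. (edist (xs!i) y, y)) xs" if "i < length xs" for i
    using that by (intro nth_equalityI) (auto simp: val_stored_dist)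
  have "M = fold (\<lambda>i M. M(xs!i \<mapsto> ?q (xs!i))) [0..<length xs] Map.empty"
    unfolding M_def phase2_tm_def val_fold_tm
    by (rule fold_cong) (auto simp: tm_simps map_put_tm_def val_map_tm m fun_eq_iff)
  then show ?thesis using assms(2) * by (auto simp: in_set_conv_nth image_iff)
qed

lemma ball_tm_correct:
  fixes xs h pivot
  defines "M \<equiv> val (phase2_tm pivot h xs (val (phase1_tm xs)))"
  assumes x: "x \<in> set xs" and m: "1 \<le> m" "m \<le> length xs"
  shows "distinct (val (ball_tm h M m x)) \<and>
    set (val (ball_tm h M m x)) = {y \<in> set xs. edist x y \<le> sort (map (edist x) xs) ! (m - 1)}"
proof -
  define zs where "zs = val (quicksort_tm pivot (map (\<lambda>y. (edist x y, y)) xs))"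
  have M: "M x = Some zs" unfolding M_def zs_def using phase2_tm_correct[OF x] .
  have q: "mset zs = mset (map (\<lambda>y. (edist x y, y)) xs)" "sorted (map fst zs)"
    unfolding zs_def using quicksort_tm_correct by blast+
  have "mset (map fst zs) = image_mset fst (mset zs)" by simp
  also have "\<dots> = mset (map (edist x) xs)" unfolding q(1) by (simp add: multiset.map_comp o_def)
  finally have "map fst zs = sort (map (edist x) xs)" using q(2)
    by (metis properties_for_sort)
  moreover have len: "length zs = length xs" using q(1) by (metis length_map size_mset)
  ultimately have r: "fst (zs ! (m-1)) = sort (map (edist x) xs) ! (m - 1)"
    using m by (metis nth_map Suc_diff_1 Suc_le_lessD less_eq_Suc_le One_nat_def)
  have s: "set zs = (\<lambda>y. (edist x y, y)) ` set xs" using q(1) by (metis set_map set_mset_mset)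
  define R where "R = sort (map (edist x) xs) ! (m - 1)"
  have v: "val (ball_tm h M m x) = val (collect_tm h R zs [])"
    using r by (simp add: ball_tm_def tm_simps map_get_tm_def M R_def)
  have "snd ` {z \<in> set zs. fst z \<le> R} = {y \<in> set xs. edist x y \<le> R}"
    unfolding s by (auto simp: image_iff)
  then show ?thesis using collect_tm_correct[OF q(2), of "[]" h R] unfolding v R_def by simp
qed

text \<open>The computed level set is the intersection of the balls, as a set of points.\<close>

lemma level_set_tm_correct:
  fixes xs h pivot
  defines "M \<equiv> val (phase2_tm pivot h xs (val (phase1_tm xs)))"
  assumes m: "1 \<le> m" "m \<le> length xs"
  shows "distinct (val (level_set_tm h xs M m)) \<and>
    set (val (level_set_tm h xs M m)) = (\<Inter>x\<in>set xs. {y \<in> set xs. edist x y \<le> sort (map (edist x) xs) ! (m - 1)})"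
proof -
  let ?B = "\<lambda>x. {y \<in> set xs. edist x y \<le> sort (map (edist x) xs) ! (m - 1)}"
  note b = ball_tm_correct[OF _ m, of _ h pivot, folded M_def]
  have f: "\<lbrakk>distinct S; set is \<subseteq> {..<length xs}\<rbrakk> \<Longrightarrow> 
    distinct (fold (\<lambda>j S. val (set_inter_tm h S (val (ball_tm h M m (xs!j))))) is S) \<and>
    set (fold (\<lambda>j S. val (set_inter_tm h S (val (ball_tm h M m (xs!j))))) is S) = set S \<inter> (\<Inter>j\<in>set is. ?B (xs!j))" for "is" S
    by (induction "is" arbitrary: S) (auto simp: set_inter_tm_correct b)
  obtain a ys where xs: "xs = a # ys" using m by (cases xs) auto
  have ss: "set xs = insert (xs!0) ((!) xs ` {1..<length xs})"
  proof -
    have "{0..<length xs} = insert 0 {1..<length xs}" using m by auto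
    then have "(!) xs ` {0..<length xs} = insert (xs!0) ((!) xs ` {1..<length xs})" by simp
    moreover have "set xs = (!) xs ` {0..<length xs}" by (force simp: set_conv_nth)
    ultimately show ?thesis by simp
  qed
  have x0: "xs!0 \<in> set xs" using xs by simp
  have gen: "(\<Inter>x\<in>set xs. F x) = F (xs!0) \<inter> (\<Inter>j\<in>{1..<length xs}. F (xs!j))" for F :: "point \<Rightarrow> point set"
    by (subst ss) auto
  have "(\<Inter>x\<in>set xs. ?B x) = ?B (xs!0) \<inter> (\<Inter>j\<in>{1..<length xs}. ?B (xs!j))"
    by (rule gen)
  moreover have "val (level_set_tm h xs M m) = fold (\<lambda>j S. val (set_inter_tm h S (val (ball_tm h M m (xs!j))))) [1..<length xs] (val (ball_tm h M m (xs!0)))"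
    by (simp add: level_set_tm_def val_fold_tm tm_simps)
  moreover have "set [1..<length xs] \<subseteq> {..<length xs}" by auto
  ultimately show ?thesis using f[of "val (ball_tm h M m (xs!0))" "[1..<length xs]"] b[OF x0]
    by (simp only: set_upt simp_thms)
qed

subsection \<open>Quicksort with a suitable pivot rule needs \<open>O(n log n)\<close> comparisons\<close>

lemma median_pivot_comparisons:
  "\<exists>pivot :: real list \<Rightarrow> nat. \<forall>zs :: (real \<times> 'a) list. 
     real (time (quicksort_tm pivot zs)) \<le> 2 * (real (length zs) * log 2 (length zs))"
proof -
  define pivot :: "real list \<Rightarrow> nat" where "pivot ks = (SOME i. i < length ks \<and> ks ! i = sort ks ! (length ks div 2))" for ks
  have piv: "pivot ks < length ks \<and> ks ! pivot ks = sort ks ! (length ks div 2)" if "ks \<noteq> []" for ks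
  proof -
    have "sort ks ! (length ks div 2) \<in> set ks" using that
      by (metis set_sort length_sort nth_mem length_greater_0_conv div_less_dividend one_less_numeral_iff semiring_norm(76))
    then show ?thesis unfolding pivot_def in_set_conv_nth by (rule someI_ex)
  qed
  have half: "length (filter (\<lambda>k. k < sort ks ! (length ks div 2)) ks) \<le> length ks div 2" 
     "length (filter (\<lambda>k. sort ks ! (length ks div 2) < k) ks) \<le> length ks div 2"  for ks :: "real list"
  proof -
    define ss where "ss = sort ks"
    let ?n = "length ks"
    have n: "length ss = ?n" by (simp add: ss_def)
    have srt: "sorted ss" by (simp add: ss_def)
    have fl: "length (filter P ks) = card {i. i < ?n \<and> P (ss!i)}" for P
      by (metis length_filter_conv_card mset_filter mset_sort n size_mset ss_def)
    have "{i. i < ?n \<and> ss!i < ss!(?n div 2)} \<subseteq> {..<?n div 2}"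
      using srt n by (auto simp: sorted_iff_nth_mono) (meson leD leI)
    then show "length (filter (\<lambda>k. k < sort ks ! (length ks div 2)) ks) \<le> length ks div 2"
      unfolding fl ss_def[symmetric] using card_mono[of "{..<?n div 2}"] by force
    have "{i. i < ?n \<and> ss!(?n div 2) < ss!i} \<subseteq> {?n div 2<..<?n}"
      proof -
      have "ss!i \<le> ss!(?n div 2)" if "i < ?n" "i \<le> ?n div 2" for i
        using that srt n by (intro sorted_nth_mono) auto
      then show ?thesis by (force simp: not_le[symmetric])
    qed
    then have "card {i. i < ?n \<and> ss!(?n div 2) < ss!i} \<le> card {?n div 2<..<?n}" by (intro card_mono) auto
    also have "\<dots> \<le> ?n div 2" by simp
    finally show "length (filter (\<lambda>k. sort ks ! (length ks div 2) < k) ks) \<le> length ks div 2"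
      unfolding fl ss_def[symmetric] .
  qed
  have sp: "time (split3_tm p zs) \<le> 2 * length zs" for p and zs :: "(real \<times> 'a) list"
    by (induction zs) (auto simp: tm_simps split: prod.split)
  have "real (time (quicksort_tm pivot zs)) \<le> 2 * (real (length zs) * log 2 (length zs))" for zs :: "(real \<times> 'a) list"
  proof (induction "length zs" arbitrary: zs rule: less_induct)
    case less
    show ?case
    proof (cases "length zs \<le> 1")
      case True
      then have "length zs = 0 \<or> length zs = 1" by linarith
      moreover have "time (quicksort_tm pivot zs) = 0" using True by (subst quicksort_tm.simps) (simp add: return_tm_def)
      ultimately show ?thesis by auto
    next
      case False
      define p where "p = pivot_key pivot zs"
      have pm: "p = sort (map fst zs) ! (length zs div 2)"
        using piv[of "map fst zs"] False by (cases zs) (auto simp: p_def pivot_key_def)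
      let ?l = "filter (\<lambda>z. fst z < p) zs" and ?g = "filter (\<lambda>z. p < fst z) zs"
      let ?n = "length zs"
      have hl: "length ?l \<le> ?n div 2" and hg: "length ?g \<le> ?n div 2"
        using half[of "map fst zs"] by (simp_all add: pm filter_map o_def)
      have lg: "length ?l + length ?g \<le> ?n" 
        by (induction zs) auto
      have n0: "real ?n > 0" using False by linarith
      have bound: "real a * log 2 a \<le> real a * (log 2 ?n - 1)" if "a \<le> ?n div 2" for a
      proof (cases "a = 0")
        case False
        have "real a \<le> real ?n / 2" using that by linarith
        then have "log 2 a \<le> log 2 (real ?n / 2)" using False by (intro log_mono) auto
        also have "\<dots> = log 2 ?n - 1" using n0 log_divide_pos[of "real ?n" 2 2] by simp
        finally show ?thesis by (intro mult_left_mono) auto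
      qed auto
      have "time (quicksort_tm pivot zs) \<le> 2 * ?n + time (quicksort_tm pivot ?l) + time (quicksort_tm pivot ?g)"
      proof -
        have "time (quicksort_tm pivot zs) =
            time (split3_tm p zs) + (time (quicksort_tm pivot ?l) + time (quicksort_tm pivot ?g))"
          using False
          by (simp add: quicksort_tm.simps[of pivot zs] bind_tm_def return_tm_def val_split3_tm p_def)
        then show ?thesis using sp[of p zs] by linarith
      qed
      then have "real (time (quicksort_tm pivot zs)) \<le> 2 * ?n + time (quicksort_tm pivot ?l) + time (quicksort_tm pivot ?g)" by linarith
      also have "\<dots> \<le> 2 * ?n + 2 * (real (length ?l) * (log 2 ?n - 1)) + 2 * (real (length ?g) * (log 2 ?n - 1))"
      proof -
        have "length ?l < ?n" "length ?g < ?n" using hl hg False by linarith+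
        from less[OF this(1)] less[OF this(2)] bound[OF hl] bound[OF hg] show ?thesis by linarith
      qed
      also have "\<dots> = 2 * ?n + 2 * (real (length ?l + length ?g) * (log 2 ?n - 1))" by (simp add: algebra_simps)
      also have "\<dots> \<le> 2 * ?n + 2 * (real ?n * (log 2 ?n - 1))"
      proof -
        have "real ?n \<ge> 2" using False by linarith
        then have "log 2 ?n \<ge> 1" using log_mono[of 2 2 "real ?n"] by simp
        then have "real (length ?l + length ?g) * (log 2 ?n - 1) \<le> real ?n * (log 2 ?n - 1)"
          using lg by (intro mult_right_mono) linarith+
        then show ?thesis by linarith
      qed
      finally show ?thesis by (simp add: algebra_simps)
    qed
  qed
  then show ?thesis by blast
qed

text \<open>
  So a worst-case bound of order \<open>n log n\<close> on the number of comparisons of quicksort, as assumed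
  for the running time analysis, is satisfiable; it depends on the pivot rule.
\<close>

lemma quicksort_n_log_n_satisfiable:
  "\<exists>(pivot :: real list \<Rightarrow> nat) (T :: nat \<Rightarrow> nat).
     (\<forall>zs :: (real \<times> 'a) list. time (quicksort_tm pivot zs) \<le> T (length zs)) \<and>
     (\<lambda>n. real (T n)) \<in> O(\<lambda>n. real n * ln (real n))"
proof -
  obtain pivot :: "real list \<Rightarrow> nat" where pivot: "\<And>zs :: (real \<times> 'a) list.
      real (time (quicksort_tm pivot zs)) \<le> 2 * (real (length zs) * log 2 (length zs))"
    using median_pivot_comparisons by blast
  define T where "T n = nat \<lceil>2 * (real n * log 2 (real n))\<rceil>" for n :: nat
  have "time (quicksort_tm pivot zs) \<le> T (length zs)" for zs :: "(real \<times> 'a) list"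
    using pivot[of zs] unfolding T_def by linarith
  moreover have "(\<lambda>n. real (T n)) \<in> O(\<lambda>n. real n * ln (real n))"
  proof (rule bigoI)
    show "\<forall>\<^sub>F n in sequentially. norm (real (T n)) \<le> (2 / ln 2 + 1) * norm (real n * ln (real n))"
      using eventually_ge_at_top[of 3]
    proof eventually_elim
      case (elim n)
      have "ln (real n) \<ge> 1"
        using elim exp_le by (subst ln_ge_iff) linarith+
      then have 1: "real n * ln (real n) \<ge> 1"
        using elim mult_mono[of 1 "real n" 1 "ln (real n)"] by simp
      have "real (T n) \<le> 2 * (real n * log 2 (real n)) + 1"
        unfolding T_def using elim by (simp add: of_nat_nat)
      also have "2 * (real n * log 2 (real n)) = 2 / ln 2 * (real n * ln (real n))"
        by (simp add: log_def)
      finally show ?case using 1 by (simp add: algebra_simps)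
    qed
  qed
  ultimately show ?thesis by blast
qed

end

theory Submission
  imports Defs
begin

text \<open>
  The number of neighbours that define a ball is at least one at the start and drops by exactly
  one in every pass of the loop. Once it is one, every ball is a single point, so the level set has
  at most one element and the loop stops. A pass costs \<open>O(n\<^sup>2)\<close> because no hash set ever exceeds
  \<open>n\<close> elements, the \<open>O(n\<^sup>2)\<close> distances cost \<open>O(d)\<close> each, and the \<open>n\<close> sorting runs account for
  \<open>n\<^sup>2 log n\<close>.
\<close>

subsection \<open>Cost of the loop constructs\<close>

lemma val_return_tm [simp]: "val (return_tm v) = v"
  and time_return_tm [simp]: "time (return_tm v) = 0"
  by (simp_all add: return_tm_def)

lemma val_op [simp]: "val (op v) = v"
  and time_op [simp]: "time (op v) = 1"
  by (simp_all add: op_def)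

lemma val_bind_tm [simp]: "val (bind_tm p f) = val (f (val p))"
  and time_bind_tm [simp]: "time (bind_tm p f) = time p + time (f (val p))"
  by (simp_all add: bind_tm_def)

lemma time_map_tm_le:
  assumes "\<And>x. x \<in> set xs \<Longrightarrow> time (f x) \<le> c"
  shows "time (map_tm f xs) \<le> length xs * (c + 1)"
  using assms
proof (induction xs)
  case (Cons x xs)
  then have "time (f x) \<le> c" and "time (map_tm f xs) \<le> length xs * (c + 1)"
    by auto
  then show ?case by simp
qed simp

lemma time_fold_tm_invariant_le:
  assumes "I s"
    and "\<And>x s. x \<in> set xs \<Longrightarrow> I s \<Longrightarrow> I (val (f x s))"
    and "\<And>x s. x \<in> set xs \<Longrightarrow> I s \<Longrightarrow> time (f x s) \<le> c"
  shows "time (fold_tm f xs s) \<le> length xs * (c + 1)"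
  using assms
proof (induction xs arbitrary: s)
  case (Cons x xs)
  then have "time (f x s) \<le> c" and "time (fold_tm f xs (val (f x s))) \<le> length xs * (c + 1)"
    by auto
  then show ?case by simp
qed simp

lemma time_fold_tm_le:
  assumes "\<And>x s. x \<in> set xs \<Longrightarrow> time (f x s) \<le> c"
  shows "time (fold_tm f xs s) \<le> length xs * (c + 1)"
  by (rule time_fold_tm_invariant_le[where I = "\<lambda>_. True"]) (use assms in auto)

lemma while_tm_amortized:
  fixes rank potential :: "'s \<Rightarrow> nat"
  assumes "I s"
    and invariant: "\<And>s. I s \<Longrightarrow> b s \<Longrightarrow> I (val (f s))"
    and decrease: "\<And>s. I s \<Longrightarrow> b s \<Longrightarrow> rank (val (f s)) < rank s"
    and payment: "\<And>s. I s \<Longrightarrow> b s \<Longrightarrow> potential s + time (f s) + 1 \<le> potential (val (f s))"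
  obtains s' t where "while_tm b f s = Some (TM s' t)" and "t + potential s \<le> potential s' + 1"
proof -
  let ?guard = "\<lambda>m. b (val m)" and ?body = "\<lambda>m. do { s' \<leftarrow> m; s'' \<leftarrow> f s'; op s'' }"
  let ?J = "\<lambda>m. I (val m) \<and> time m + potential s \<le> potential (val m) + 1"
  have step: "?J (?body m) \<and> rank (val (?body m)) < rank (val m)" if "?J m" "?guard m" for m
    using that invariant[of "val m"] decrease[of "val m"] payment[of "val m"] by simp
  have init: "?J (op s)"
    using \<open>I s\<close> by simp
  have "\<exists>m. while_option ?guard ?body (op s) = Some m"
    using step init
    by (rule measure_while_option_Some[where P = ?J and f = "\<lambda>m. rank (val m)"])
  then obtain m where m: "while_option ?guard ?body (op s) = Some m" ..
  have "?J m"
    using step[THEN conjunct1] m init by (rule while_option_rule[where P = ?J])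
  then show thesis
    using that[of "val m" "time m"] m by (simp add: while_tm_def)
qed

subsection \<open>Distances and sorting\<close>

lemma time_euclid_dist_tm_le: "time (euclid_dist_tm x y) \<le> 3 * length x + 1"
proof -
  have "time (sq_dist_tm x y) \<le> 3 * length x"
    by (induction x y rule: sq_dist_tm.induct) auto
  then show ?thesis by (simp add: euclid_dist_tm_def)
qed

lemma time_phase1_tm_le:
  assumes "\<And>x. x \<in> set xs \<Longrightarrow> length x \<le> d"
  shows "time (phase1_tm xs) \<le> length xs * (length xs * (3 * d + 4) + 1)"
proof -
  let ?row = "\<lambda>i. map_tm (\<lambda>j. do { x \<leftarrow> op (xs ! i); y \<leftarrow> op (xs ! j); euclid_dist_tm x y }) [0..<i]"
  have "time (?row i) \<le> length xs * (3 * d + 4)" if "i \<in> set [1..<length xs]" for i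
  proof -
    have "length (xs ! i) \<le> d"
      using that assms by simp
    then have dist: "time (euclid_dist_tm (xs ! i) y) \<le> 3 * d + 1" for y
      using time_euclid_dist_tm_le[of "xs ! i" y] by linarith
    have "time (?row i) \<le> length [0..<i] * (3 * d + 3 + 1)"
      using dist by (intro time_map_tm_le) simp
    also have "\<dots> \<le> length xs * (3 * d + 4)"
      using that by (intro mult_mono) auto
    finally show ?thesis .
  qed
  then have "time (phase1_tm xs) \<le> length [1..<length xs] * (length xs * (3 * d + 4) + 1)"
    unfolding phase1_tm_def by (rule time_map_tm_le)
  also have "\<dots> \<le> length xs * (length xs * (3 * d + 4) + 1)"
    by (intro mult_right_mono) auto
  finally show ?thesis .
qed

lemma time_phase2_tm_le:
  assumes "\<And>zs :: (real \<times> point) list. length zs = length xs \<Longrightarrow> time (quicksort_tm pivot zs) \<le> q"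
  shows "time (phase2_tm pivot h xs tri) \<le> length xs * (3 * length xs + q + h + 2)"
proof -
  let ?ds = "\<lambda>i. map_tm (\<lambda>j. do { r \<leftarrow> stored_dist_tm tri i j; y \<leftarrow> op (xs ! j); return_tm (r, y) })
    [0..<length xs]"
  have row_time: "time (?ds i) \<le> length [0..<length xs] * (2 + 1)" for i
    by (rule time_map_tm_le) (simp add: stored_dist_tm_def)
  have sort_time: "time (quicksort_tm pivot (val (?ds i))) \<le> q" for i
    by (rule assms) (simp add: val_map_tm)
  have "time (do { x \<leftarrow> op (xs ! i); ds \<leftarrow> ?ds i; zs \<leftarrow> quicksort_tm pivot ds; map_put_tm h x zs M })
      \<le> 3 * length xs + q + h + 1" for i M
    using row_time[of i] sort_time[of i] by (simp add: map_put_tm_def)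
  then have "time (phase2_tm pivot h xs tri)
      \<le> length [0..<length xs] * (3 * length xs + q + h + 1 + 1)"
    unfolding phase2_tm_def by (rule time_fold_tm_le)
  then show ?thesis by simp
qed

definition neighbour_map ::
    "(real list \<Rightarrow> nat) \<Rightarrow> nat \<Rightarrow> point list \<Rightarrow> (point \<rightharpoonup> (real \<times> point) list)" where
  "neighbour_map pivot h xs = val (phase2_tm pivot h xs (val (phase1_tm xs)))"

lemma length_val_quicksort_tm: "length (val (quicksort_tm pivot zs)) = length zs"
  using quicksort_tm_correct by (metis size_mset)

lemma length_neighbour_map:
  "x \<in> set xs \<Longrightarrow> length (the (neighbour_map pivot h xs x)) = length xs"
  by (simp add: neighbour_map_def phase2_tm_correct length_val_quicksort_tm)

subsection \<open>Level sets\<close>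

lemma length_le_if_distinct_subset:
  assumes "distinct xs" and "set xs \<subseteq> set ys"
  shows "length xs \<le> length ys"
proof -
  have "length xs = card (set xs)"
    using assms(1) by (simp add: distinct_card)
  also have "\<dots> \<le> card (set ys)"
    using assms(2) by (simp add: card_mono)
  also have "\<dots> \<le> length ys"
    by (rule card_length)
  finally show ?thesis .
qed

lemma length_val_collect_tm_le:
  "length (val (collect_tm h r zs s)) \<le> length s + length zs"
proof (induction zs arbitrary: s)
  case (Cons z zs)
  have "length (val (collect_tm h r zs (List.insert y s))) \<le> length s + Suc (length zs)" for y
    using Cons.IH[of "List.insert y s"] by (simp add: List.insert_def split: if_splits)
  then show ?case
    by (cases z) (simp add: set_insert_tm_def)
qed simp

lemma time_collect_tm_le: "time (collect_tm h r zs s) \<le> length zs * (h + 1)"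
proof (induction zs arbitrary: s)
  case (Cons z zs)
  then show ?case
    by (cases z) (simp add: set_insert_tm_def)
qed simp

lemma length_val_ball_tm_le: "length (val (ball_tm h M m x)) \<le> length (the (M x))"
  using length_val_collect_tm_le[of h _ "the (M x)" "[]"]
  by (simp add: ball_tm_def map_get_tm_def)

lemma time_ball_tm_le:
  assumes "length (the (M x)) \<le> n"
  shows "time (ball_tm h M m x) \<le> (n + 1) * (h + 1)"
proof -
  have "time (ball_tm h M m x) \<le> (length (the (M x)) + 1) * (h + 1)"
    using time_collect_tm_le[of h _ "the (M x)" "[]"]
    by (simp add: ball_tm_def map_get_tm_def)
  also have "\<dots> \<le> (n + 1) * (h + 1)"
    using assms by (intro mult_right_mono) auto
  finally show ?thesis .
qed

lemma length_val_set_inter_tm_le: "length (val (set_inter_tm h s t)) \<le> length s"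
  using set_inter_tm_correct[of h s t] by (simp add: length_le_if_distinct_subset)

lemma time_set_inter_tm_le:
  assumes "length s \<le> n"
  shows "time (set_inter_tm h s t) \<le> n * (2 * h + 1)"
proof -
  have "time (set_inter_tm h s t) \<le> length s * (2 * h + 1)"
    unfolding set_inter_tm_def
    by (rule time_fold_tm_le) (simp add: set_member_tm_def set_insert_tm_def)
  also have "\<dots> \<le> n * (2 * h + 1)"
    using assms by (intro mult_right_mono) auto
  finally show ?thesis .
qed

lemma time_level_set_tm_le:
  assumes "xs \<noteq> []" and M: "\<And>x. x \<in> set xs \<Longrightarrow> length (the (M x)) \<le> length xs"
  shows "time (level_set_tm h xs M m) \<le> (4 * h + 5) * (length xs)\<^sup>2"
proof -
  define n where "n = length xs"
  have n: "1 \<le> n"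
    using \<open>xs \<noteq> []\<close> by (simp add: n_def Suc_le_eq)
  let ?ball = "\<lambda>j. ball_tm h M m (xs ! j)"
  let ?step = "\<lambda>j S. do { y \<leftarrow> op (xs ! j); B \<leftarrow> ball_tm h M m y; set_inter_tm h S B }"
  have ball_length: "length (val (?ball j)) \<le> n" and ball_time: "time (?ball j) \<le> (n + 1) * (h + 1)"
    if "j < n" for j
    using that M[of "xs ! j"] length_val_ball_tm_le[of h M m "xs ! j"]
      time_ball_tm_le[of M "xs ! j" n h m]
    by (simp_all add: n_def)
  define c where "c = (n + 1) * (h + 1) + n * (2 * h + 1) + 1"
  have "time (fold_tm ?step [1..<n] (val (?ball 0))) \<le> length [1..<n] * (c + 1)"
  proof (rule time_fold_tm_invariant_le[where I = "\<lambda>S. length S \<le> n"])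
    show "length (val (?ball 0)) \<le> n"
      using ball_length n by simp
    fix j :: nat and S :: "point list"
    assume j: "j \<in> set [1..<n]" and S: "length S \<le> n"
    show "length (val (?step j S)) \<le> n"
      using length_val_set_inter_tm_le[of h S "val (?ball j)"] S by simp
    show "time (?step j S) \<le> c"
      using ball_time[of j] time_set_inter_tm_le[OF S, of h "val (?ball j)"] j
      by (simp add: c_def algebra_simps)
  qed
  moreover have "time (?ball 0) + 1 \<le> c"
    using ball_time[of 0] n by (simp add: c_def algebra_simps)
  ultimately have "time (level_set_tm h xs M m) \<le> (c + 1) + (n - 1) * (c + 1)"
    by (simp add: level_set_tm_def n_def)
  also have "\<dots> = n * (c + 1)"
    using n by (cases n) auto
  also have "c + 1 \<le> (4 * h + 5) * n"
    using n mult_left_mono[OF n, of "h + 3"] by (simp add: c_def algebra_simps)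
  finally show ?thesis
    by (simp add: n_def power2_eq_square algebra_simps)
qed

lemma edist_le_zero_iff:
  assumes "length x = length y"
  shows "edist x y \<le> 0 \<longleftrightarrow> x = y"
proof -
  have "edist x y \<le> 0 \<longleftrightarrow> edist x y = 0"
    using L2_set_nonneg by (simp add: edist_def val_euclid_dist[OF assms] order_antisym_conv)
  also have "\<dots> \<longleftrightarrow> (\<forall>i < length x. x ! i = y ! i)"
    by (auto simp: edist_def val_euclid_dist[OF assms] L2_set_eq_0_iff)
  also have "\<dots> \<longleftrightarrow> x = y"
    using assms by (auto intro: nth_equalityI)
  finally show ?thesis .
qed

lemma sort_nth_0_le:
  assumes "a \<in> set as"
  shows "sort as ! 0 \<le> a"
proof -
  obtain i where "i < length (sort as)" and "sort as ! i = a"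
    using assms by (metis in_set_conv_nth set_sort)
  then show ?thesis
    using sorted_nth_mono[OF sorted_sort, of 0 i as] by simp
qed

lemma length_level_set_tm_1_le:
  assumes "\<forall>x \<in> set xs. length x = d" and "xs \<noteq> []"
  shows "length (val (level_set_tm h xs (neighbour_map pivot h xs) 1)) \<le> 1"
proof -
  let ?S = "val (level_set_tm h xs (neighbour_map pivot h xs) 1)"
  define x where "x = hd xs"
  have x: "x \<in> set xs"
    using assms(2) by (simp add: x_def)
  have "1 \<le> length xs"
    using assms(2) by (simp add: Suc_le_eq)
  then have distinct: "distinct ?S"
    and S: "set ?S = (\<Inter>x\<in>set xs. {y \<in> set xs. edist x y \<le> sort (map (edist x) xs) ! 0})"
    using level_set_tm_correct[of 1 xs h pivot] by (simp_all add: neighbour_map_def)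
  have "0 \<in> set (map (edist x) xs)"
    using x edist_self[of x] by (force simp: image_iff)
  then have radius: "sort (map (edist x) xs) ! 0 \<le> 0"
    by (rule sort_nth_0_le)
  have "y = x" if "y \<in> set ?S" for y
  proof -
    have "y \<in> set xs" and "edist x y \<le> sort (map (edist x) xs) ! 0"
      using that x unfolding S by auto
    then show ?thesis
      using radius x assms(1) edist_le_zero_iff[of x y] by simp
  qed
  then have "set ?S \<subseteq> set [x]"
    by auto
  with distinct have "length ?S \<le> length [x]"
    by (rule length_le_if_distinct_subset)
  then show ?thesis by simp
qed

subsection \<open>The iteration\<close>

definition neighbour_count :: "nat \<Rightarrow> real \<Rightarrow> nat" where
  "neighbour_count n \<alpha> = nat \<lfloor>real n * (1 - \<alpha>) + 1\<rfloor>"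

lemma neighbour_count_pos:
  assumes "\<alpha> \<le> 1"
  shows "0 < neighbour_count n \<alpha>"
proof -
  have "0 \<le> real n * (1 - \<alpha>)"
    using assms by simp
  then show ?thesis
    unfolding neighbour_count_def by linarith
qed

lemma neighbour_count_add_inverse:
  assumes "0 < n"
  shows "neighbour_count n (\<alpha> + 1 / real n) = neighbour_count n \<alpha> - 1"
proof -
  have "real n * (1 - (\<alpha> + 1 / real n)) = real n * (1 - \<alpha>) - 1"
    using assms by (simp add: field_simps)
  then show ?thesis
    unfolding neighbour_count_def by linarith
qed

lemma val_iteration_tm:
  fixes h \<alpha> M xs
  defines "S \<equiv> val (level_set_tm h xs M (neighbour_count (length xs) \<alpha>))"
  shows "val (iteration_tm h xs M (\<alpha>, sz, k, Ss)) =
    (\<alpha> + 1 / real (length xs), length S, k + 1, (\<alpha>, S) # Ss)"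
  by (simp add: iteration_tm_def neighbour_count_def S_def)

lemma time_iteration_tm_le:
  assumes "xs \<noteq> []" and "\<And>x. x \<in> set xs \<Longrightarrow> length (the (M x)) \<le> length xs"
  shows "time (iteration_tm h xs M s) + 1 \<le> (4 * h + 15) * (length xs)\<^sup>2"
proof -
  obtain \<alpha> sz k Ss where s: "s = (\<alpha>, sz, k, Ss)"
    by (rule prod_cases4)
  let ?m = "neighbour_count (length xs) \<alpha>"
  have "time (iteration_tm h xs M s) = time (level_set_tm h xs M ?m) + 9"
    by (simp add: s iteration_tm_def neighbour_count_def)
  moreover have "time (level_set_tm h xs M ?m) \<le> (4 * h + 5) * (length xs)\<^sup>2"
    using assms by (rule time_level_set_tm_le)
  moreover have "1 \<le> (length xs)\<^sup>2"
    using assms(1) by (simp add: Suc_le_eq)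
  ultimately show ?thesis
    by (simp add: algebra_simps)
qed

lemma neighbour_count_pos_after_nontrivial_level_set:
  assumes "0 < n" and "0 < neighbour_count n \<alpha>"
    and "length (val (level_set_tm h xs M 1)) \<le> 1"
    and "1 < length (val (level_set_tm h xs M (neighbour_count n \<alpha>)))"
  shows "0 < neighbour_count n (\<alpha> + 1 / real n)"
proof -
  have "neighbour_count n \<alpha> \<noteq> 1"
    using assms(3,4) by auto
  then show ?thesis
    using assms(1,2) by (simp add: neighbour_count_add_inverse)
qed

lemma phase3_tm_time_le:
  fixes xs :: "point list"
  defines "n \<equiv> length xs"
  assumes "xs \<noteq> []" and "\<alpha>\<^sub>1 \<le> 1"
    and M: "\<And>x. x \<in> set xs \<Longrightarrow> length (the (M x)) \<le> n"
    and singleton: "length (val (level_set_tm h xs M 1)) \<le> 1"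
  obtains \<alpha> sz k Ss t where "phase3_tm h xs M \<alpha>\<^sub>1 = Some (TM (\<alpha>, sz, k, Ss) t)"
    and "t \<le> length Ss * ((4 * h + 15) * n\<^sup>2) + 1"
proof -
  let ?pass = "iteration_tm h xs M" and ?guard = "\<lambda>(\<alpha>, sz, k, Ss). 1 < sz"
  let ?I = "\<lambda>(\<alpha>, sz, k, Ss). 1 < sz \<longrightarrow> 0 < neighbour_count n \<alpha>"
  let ?rank = "\<lambda>(\<alpha>, sz, k, Ss). neighbour_count n \<alpha>"
  let ?potential = "\<lambda>(\<alpha>, sz, k, Ss). length Ss * ((4 * h + 15) * n\<^sup>2)"
  have step: "?I (val (?pass s)) \<and> ?rank (val (?pass s)) < ?rank s \<and>
      ?potential s + time (?pass s) + 1 \<le> ?potential (val (?pass s))"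
    if I: "?I s" and guard: "?guard s" for s
  proof -
    obtain \<alpha> sz k Ss where s: "s = (\<alpha>, sz, k, Ss)"
      by (rule prod_cases4)
    define S where "S = val (level_set_tm h xs M (neighbour_count n \<alpha>))"
    have pass: "val (?pass s) = (\<alpha> + 1 / real n, length S, k + 1, (\<alpha>, S) # Ss)"
      by (simp add: s val_iteration_tm S_def n_def)
    have n: "0 < n" and count: "0 < neighbour_count n \<alpha>"
      using \<open>xs \<noteq> []\<close> I guard by (simp_all add: n_def s)
    have "1 < length S \<longrightarrow> 0 < neighbour_count n (\<alpha> + 1 / real n)"
      unfolding S_def using n count singleton neighbour_count_pos_after_nontrivial_level_set by blast
    moreover have "time (?pass s) + 1 \<le> (4 * h + 15) * n\<^sup>2"
      using time_iteration_tm_le \<open>xs \<noteq> []\<close> M unfolding n_def by blast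
    ultimately show ?thesis
      using n count unfolding pass by (simp add: s neighbour_count_add_inverse)
  qed
  obtain s t where loop: "phase3_tm h xs M \<alpha>\<^sub>1 = Some (TM s t)"
    and t: "t + ?potential (\<alpha>\<^sub>1, length xs, 1, []) \<le> ?potential s + 1"
    unfolding phase3_tm_def
    by (rule while_tm_amortized[of ?I "(\<alpha>\<^sub>1, length xs, 1, [])" ?guard ?pass ?rank ?potential])
       (use step \<open>\<alpha>\<^sub>1 \<le> 1\<close> in \<open>auto simp: neighbour_count_pos\<close>)
  obtain \<alpha> sz k Ss where "s = (\<alpha>, sz, k, Ss)"
    by (rule prod_cases4)
  with loop t show thesis
    by (intro that) auto
qed

subsection \<open>Total running time\<close>

lemma bigo_sequentially_affine_bound:
  fixes f g :: "nat \<Rightarrow> real"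
  assumes "f \<in> O(g)"
  obtains c K where "0 < c" and "0 \<le> K" and "\<And>n. \<bar>f n\<bar> \<le> c * \<bar>g n\<bar> + K"
proof -
  obtain c N where c: "0 < c" and N: "\<And>n. N \<le> n \<Longrightarrow> \<bar>f n\<bar> \<le> c * \<bar>g n\<bar>"
    using landau_o.bigE[OF assms] unfolding eventually_sequentially real_norm_def by metis
  define K where "K = (\<Sum>n<N. \<bar>f n\<bar>)"
  have K: "0 \<le> K"
    by (simp add: K_def sum_nonneg)
  have "\<bar>f n\<bar> \<le> c * \<bar>g n\<bar> + K" for n
  proof (cases "n < N")
    case True
    then have "\<bar>f n\<bar> \<le> K"
      unfolding K_def by (intro member_le_sum) auto
    then show ?thesis
      using c by (simp add: add_increasing)
  next
    case False
    then show ?thesis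
      using N[of n] K by simp
  qed
  with c K show thesis
    by (rule that)
qed

lemma bigo_n_ln_n_bound:
  fixes f :: "nat \<Rightarrow> real"
  assumes "f \<in> O(\<lambda>n. real n * ln (real n))"
  obtains C where "0 < C" and "\<And>n. 1 \<le> n \<Longrightarrow> f n \<le> C * (real n * ln (real n) + real n)"
proof -
  obtain c K where c: "0 < c" and K: "0 \<le> K"
    and bound: "\<And>n. \<bar>f n\<bar> \<le> c * \<bar>real n * ln (real n)\<bar> + K"
    using bigo_sequentially_affine_bound[OF assms] by blast
  have "f n \<le> (c + K) * (real n * ln (real n) + real n)" if "1 \<le> n" for n
  proof -
    have "0 \<le> real n * ln (real n)"
      using that by simp
    then have "f n \<le> c * (real n * ln (real n)) + K * 1"
      using bound[of n] by simp
    also have "\<dots> \<le> (c + K) * (real n * ln (real n)) + (c + K) * real n"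
      using that c K by (intro add_mono mult_mono) auto
    finally show ?thesis
      by (simp add: distrib_left)
  qed
  with c K show thesis
    by (intro that[of "c + K"]) auto
qed

lemma abc_depth_time_le:
  fixes xs :: "point list"
  defines "n \<equiv> length xs"
  assumes "xs \<noteq> []" and dim: "\<forall>x \<in> set xs. length x = d"
    and sort_time: "\<And>zs :: (real \<times> point) list. length zs = n \<Longrightarrow> time (quicksort_tm pivot zs) \<le> q"
  obtains Ss t where "abc_depth pivot h d xs = Some (TM Ss t)"
    and "t \<le> (3 * d + h + 13) * n\<^sup>2 + n * q + length Ss * ((4 * h + 15) * n\<^sup>2)"
proof -
  define M where "M = neighbour_map pivot h xs"
  define t\<^sub>1 t\<^sub>2 where "t\<^sub>1 = time (phase1_tm xs)"
    and "t\<^sub>2 = time (phase2_tm pivot h xs (val (phase1_tm xs)))"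
  have singleton: "length (val (level_set_tm h xs M 1)) \<le> 1"
    unfolding M_def using dim \<open>xs \<noteq> []\<close> by (rule length_level_set_tm_1_le)
  obtain \<alpha> sz k Ss t\<^sub>3
    where loop: "phase3_tm h xs M (1 / (real d + 1)) = Some (TM (\<alpha>, sz, k, Ss) t\<^sub>3)"
      and t3: "t\<^sub>3 \<le> length Ss * ((4 * h + 15) * n\<^sup>2) + 1"
    by (rule phase3_tm_time_le[of xs "1 / (real d + 1)" M h])
       (use \<open>xs \<noteq> []\<close> singleton in \<open>auto simp: M_def length_neighbour_map n_def\<close>)
  have run: "abc_depth pivot h d xs = Some (TM (rev Ss) (t\<^sub>1 + t\<^sub>2 + 2 + t\<^sub>3))"
    using loop by (simp add: abc_depth_def M_def neighbour_map_def t\<^sub>1_def t\<^sub>2_def)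
  have t1: "t\<^sub>1 \<le> (3 * d + 4) * n\<^sup>2 + n"
    using time_phase1_tm_le[of xs d] dim by (simp add: t\<^sub>1_def n_def power2_eq_square algebra_simps)
  have t2: "t\<^sub>2 \<le> 3 * n\<^sup>2 + n * q + h * n + 2 * n"
    using time_phase2_tm_le[OF sort_time[unfolded n_def]]
    by (simp add: t\<^sub>2_def n_def power2_eq_square algebra_simps)
  have "1 \<le> n"
    using \<open>xs \<noteq> []\<close> by (simp add: n_def Suc_le_eq)
  then have "n \<le> n\<^sup>2" and "1 \<le> n\<^sup>2" and "h * n \<le> h * n\<^sup>2"
    by (simp_all add: self_le_power)
  with t1 t2 t3 have "t\<^sub>1 + t\<^sub>2 + 2 + t\<^sub>3
      \<le> (3 * d + h + 13) * n\<^sup>2 + n * q + length (rev Ss) * ((4 * h + 15) * n\<^sup>2)"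
    unfolding length_rev add_mult_distrib by linarith
  with run show thesis
    by (rule that)
qed

lemma abc_depth_time_n_ln_n_le:
  fixes xs :: "point list"
  defines "n \<equiv> length xs"
  assumes "xs \<noteq> []" and "1 \<le> d" and dim: "\<forall>x \<in> set xs. length x = d"
    and sort_time: "\<And>zs :: (real \<times> point) list. length zs = n \<Longrightarrow> time (quicksort_tm pivot zs) \<le> q"
    and q: "real q \<le> c * (n * ln n + n)" and "0 \<le> c"
  obtains Ss t where "abc_depth pivot h d xs = Some (TM Ss t)"
    and "real t \<le> (4 * h + 16 + c) * ((d + length Ss) * (real n)\<^sup>2 + (real n)\<^sup>2 * ln n)"
proof -
  define C N L where "C = 4 * h + 16 + c" and "N = (real n)\<^sup>2" and "L = (real n)\<^sup>2 * ln n"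
  have "0 \<le> L"
    using \<open>xs \<noteq> []\<close> by (simp add: L_def n_def Suc_le_eq)
  obtain Ss t where run: "abc_depth pivot h d xs = Some (TM Ss t)"
    and t: "t \<le> (3 * d + h + 13) * n\<^sup>2 + n * q + length Ss * ((4 * h + 15) * n\<^sup>2)"
    using abc_depth_time_le[OF \<open>xs \<noteq> []\<close> dim sort_time[unfolded n_def]] unfolding n_def by blast
  have sorting: "real n * real q \<le> c * L + c * N"
    using mult_left_mono[OF q, of "real n"]
    by (simp add: N_def L_def power2_eq_square algebra_simps)
  have "real t \<le> (3 * d + h + 13) * N + n * real q + length Ss * ((4 * h + 15) * N)"
    using of_nat_mono[OF t, where 'a = real] by (simp add: N_def)
  also have "\<dots> \<le> (3 * d + (h + 13 + c)) * N + length Ss * (4 * real h + 15) * N + c * L"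
    using sorting by (simp add: algebra_simps)
  also have "\<dots> \<le> (C * d) * N + length Ss * C * N + C * L"
  proof -
    have "(h + 13 + c) * 1 \<le> (4 * h + 13 + c) * d"
      using \<open>1 \<le> d\<close> \<open>0 \<le> c\<close> by (intro mult_mono) auto
    then have "3 * d + (h + 13 + c) \<le> C * d"
      by (simp add: C_def algebra_simps)
    moreover have "4 * real h + 15 \<le> C" and "c \<le> C"
      using \<open>0 \<le> c\<close> by (simp_all add: C_def)
    ultimately show ?thesis
      using \<open>0 \<le> L\<close> by (intro add_mono mult_right_mono mult_left_mono) (auto simp: N_def)
  qed
  also have "\<dots> = C * ((d + length Ss) * N + L)"
    by (simp add: algebra_simps)
  finally show thesis
    using run by (intro that) (simp_all add: C_def N_def L_def)
qed

theorem theorem3p1: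
  fixes pivot :: "real list \<Rightarrow> nat"
    and T :: "nat \<Rightarrow> nat"
    and h :: nat
  assumes quicksort_comparisons:
      "\<And>zs :: (real \<times> point) list. time (quicksort_tm pivot zs) \<le> T (length zs)"
    and quicksort_n_log_n: "(\<lambda>n. real (T n)) \<in> O(\<lambda>n. real n * ln (real n))"
  shows "\<exists>C > 0. \<forall>d n :: nat. \<forall>xs :: point list.
           d \<ge> 1 \<longrightarrow> n \<ge> 1 \<longrightarrow> length xs = n \<longrightarrow> (\<forall>x \<in> set xs. length x = d) \<longrightarrow>
           (\<exists>Ss t k. abc_depth pivot h d xs = Some (TM Ss t) \<and> k = length Ss \<and>
              real t \<le> C * ((real d + real k) * real n ^ 2 + real n ^ 2 * ln (real n)))"
proof -
  obtain c where c: "0 < c"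
    and T: "\<And>n. 1 \<le> n \<Longrightarrow> real (T n) \<le> c * (real n * ln (real n) + real n)"
    using bigo_n_ln_n_bound[OF quicksort_n_log_n] by blast
  show ?thesis
  proof (intro exI[of _ "4 * real h + 16 + c"] conjI allI impI)
    fix d n :: nat and xs :: "point list"
    assume d: "1 \<le> d" and n: "1 \<le> n" "length xs = n" and dim: "\<forall>x \<in> set xs. length x = d"
    have "xs \<noteq> []"
      using n by auto
    moreover have "time (quicksort_tm pivot zs) \<le> T n"
      if "length zs = n" for zs :: "(real \<times> point) list"
      using quicksort_comparisons[of zs] that by simp
    ultimately obtain Ss t where "abc_depth pivot h d xs = Some (TM Ss t)"
      and "real t \<le> (4 * h + 16 + c) * ((d + length Ss) * (real n)\<^sup>2 + (real n)\<^sup>2 * ln n)"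
      using abc_depth_time_n_ln_n_le[of xs d pivot "T n" c h] d n dim T[of n] c by auto
    then show "\<exists>Ss t k. abc_depth pivot h d xs = Some (TM Ss t) \<and> k = length Ss \<and>
        real t \<le> (4 * real h + 16 + c) * ((real d + real k) * real n ^ 2 + real n ^ 2 * ln (real n))"
      by auto
  qed (use c in simp)
qed

end
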